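(* Let $p,q$ be positive integers and $\varphi:[0,+\infty)\to(0,+\infty)$ a non-decreasing unbounded function. Let $f_1$ be a meromorphic function and $g_1,g_2$ entire functions such that $\lambda_{g_1}(f_1)$ and $\lambda_{g_2}(f_1)$ exist. Suppose $g_1\pm g_2$ has the Property (A). Then $$\lambda_{g_1\pm g_2}(f_1)\ge \min\{\lambda_{g_1}(f_1),\lambda_{g_2}(f_1)\}.$$ Equality holds when $\lambda_{g_1}(f_1)\ne\lambda_{g_2}(f_1)$.
   Context: Meromorphic and entire functions are on the whole plane $\mathbb{C}$. $M_g(r)=\max_{|z|=r}|g(z)|$, and $T_f(r)$ is the Nevanlinna characteristic function of $f$. For a non-constant entire $g$, $T_g$ is strictly increasing and continuous, with inverse $T_g^{-1}:(|g(0)|,\infty)\to(0,\infty)$, $\lim_{s\to\infty}T_g^{-1}(s)=\infty$. Iterated logarithms: $\log^{[0]}x=x$, $\log^{[k]}x=\log(\log^{[k-1]}x)$ for $k\ge1$. For fixed positive integers $p,q$ and fixed $\varphi$, the relative $(p,q)$-$\varphi$ lower order of a meromorphic $f$ with respect to an entire $g$ (full notation $\lambda_g^{(p,q)}(f,\varphi)$, abbreviated $\lambda_g(f)$) is $\liminf_{r\to\infty}\dfrac{\log^{[p]}T_g^{-1}(T_f(r))}{\log^{[q]}\varphi(r)}$. A non-constant entire $g$ has the Property (A) if for every $\sigma>1$ and all sufficiently large $r$, $[M_g(r)]^2\le M_g(r^\sigma)$. Standing assumption: all growth indicators that occur are nonzero and finite. The symbol $\pm$ means either choice of sign, the same choice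 at every occurrence of the same expression. *)

theory Defs
  imports "HOL-Complex_Analysis.Complex_Analysis"
begin

(* The positive part makes the value at x = 0 the intended one: ln 0 = 0 in HOL. *)
definition log_plus :: "real \<Rightarrow> real" where
  "log_plus x = max 0 (ln x)"

(* Poles in the closed disc of radius t, counted with multiplicity;
   zorder is minus the multiplicity at a pole. *)
definition pole_count :: "(complex \<Rightarrow> complex) \<Rightarrow> real \<Rightarrow> real" where
  "pole_count f t = (\<Sum>z | z \<in> cball 0 t \<and> is_pole f z. real_of_int (- zorder f z))"

definition proximity_fun :: "(complex \<Rightarrow> complex) \<Rightarrow> real \<Rightarrow> real" where
  "proximity_fun f r =
     1 / (2 * pi) * integral {0..2 * pi} (\<lambda>\<theta>. log_plus (norm (f (of_real r * cis \<theta>))))"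

definition counting_fun :: "(complex \<Rightarrow> complex) \<Rightarrow> real \<Rightarrow> real" where
  "counting_fun f r =
     integral {0..r} (\<lambda>t. (pole_count f t - pole_count f 0) / t) + pole_count f 0 * ln r"

definition nevanlinna_T :: "(complex \<Rightarrow> complex) \<Rightarrow> real \<Rightarrow> real" where
  "nevanlinna_T f r = proximity_fun f r + counting_fun f r"

(* For a non-constant entire g, every s > log_plus (norm (g 0)) has exactly one preimage, so for
   all large s this is the inverse function.  Smaller s do not affect the lower limits below. *)
definition nevanlinna_T_inv :: "(complex \<Rightarrow> complex) \<Rightarrow> real \<Rightarrow> real" where
  "nevanlinna_T_inv g s = inv_into {0<..} (nevanlinna_T g) s"

definition max_modulus :: "(complex \<Rightarrow> complex) \<Rightarrow> real \<Rightarrow> real" where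
  "max_modulus g r = (SUP z\<in>sphere 0 r. norm (g z))"

definition nonconstant_entire :: "(complex \<Rightarrow> complex) \<Rightarrow> bool" where
  "nonconstant_entire g \<longleftrightarrow> g holomorphic_on UNIV \<and> \<not> g constant_on UNIV"

definition property_A :: "(complex \<Rightarrow> complex) \<Rightarrow> bool" where
  "property_A g \<longleftrightarrow> nonconstant_entire g \<and>
     (\<forall>\<sigma>>1. \<forall>\<^sub>F r in at_top. (max_modulus g r)\<^sup>2 \<le> max_modulus g (r powr \<sigma>))"

definition iter_log :: "nat \<Rightarrow> real \<Rightarrow> real" where
  "iter_log k = ln ^^ k"

definition rel_lower_order ::
  "nat \<Rightarrow> nat \<Rightarrow> (real \<Rightarrow> real) \<Rightarrow> (complex \<Rightarrow> complex) \<Rightarrow> (complex \<Rightarrow> complex) \<Rightarrow> ereal" where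
  "rel_lower_order p q \<phi> g f =
     Liminf at_top (\<lambda>r. ereal (iter_log p (nevanlinna_T_inv g (nevanlinna_T f r)) /
                               iter_log q (\<phi> r)))"

definition nonzero_finite :: "ereal \<Rightarrow> bool" where
  "nonzero_finite x \<longleftrightarrow> x \<noteq> 0 \<and> \<bar>x\<bar> \<noteq> \<infinity>"

end

theory Submission
  imports Defs
begin

text \<open>
  For entire \<open>g\<close> write \<open>M\<close> for its maximum modulus and \<open>T\<close> for its characteristic. Two facts
  make \<open>T\<close> and \<open>ln M\<close> interchangeable up to arbitrarily small changes of the exponent of the
  radius: \<open>T(R) \<le> log\<^sup>+ M(R)\<close>, and \<open>log\<^sup>+ M(R\<^sup>b) \<le> (1 + o(1)) T(R)\<close> for \<open>b < 1\<close>. Hadamard's three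
  circles theorem makes \<open>ln M(r\<^sup>a)\<close> exceed \<open>ln M(r)\<close> by a fixed factor for \<open>a > 1\<close>. Hence, if
  \<open>|h| \<le> |g\<^sub>1| + |g\<^sub>2|\<close>, the additive loss \<open>ln 2\<close> is harmless and \<open>T\<^sub>h\<^sup>-\<^sup>1(s)\<^sup>\<kappa>\<close> is at least the smaller
  of \<open>T\<^sub>1\<^sup>-\<^sup>1(s)\<close> and \<open>T\<^sub>2\<^sup>-\<^sup>1(s)\<close> for every \<open>\<kappa> > 1\<close> and large \<open>s\<close>; iterated logarithms turn the
  exponent \<open>\<kappa>\<close> into a factor at most \<open>\<kappa>\<close>. This gives the inequality for the lower orders. As each
  of \<open>h, g\<^sub>1, g\<^sub>2\<close> is bounded by the sum of the moduli of the other two, the smallest of the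
  three lower orders is attained at least twice, which is the equality statement.
\<close>

section \<open>A Poisson--Jensen bound\<close>

lemma log_plus_nonneg [simp]: "0 \<le> log_plus x"
  by (simp add: log_plus_def)

text \<open>Clamping inside the logarithm removes the singularity at 0, so continuity and
  monotonicity become immediate.\<close>

lemma log_plus_eq_ln_max: "0 \<le> x \<Longrightarrow> log_plus x = ln (max 1 x)"
  unfolding log_plus_def by (cases "x = 0") (auto simp: max_def ln_ge_zero_iff)

lemma log_plus_mono: "0 \<le> x \<Longrightarrow> x \<le> y \<Longrightarrow> log_plus x \<le> log_plus y"
  by (simp add: log_plus_eq_ln_max)

lemma continuous_on_log_plus_norm [continuous_intros]:
  fixes f :: "'a::topological_space \<Rightarrow> 'b::real_normed_vector"
  assumes "continuous_on S f"
  shows "continuous_on S (\<lambda>x. log_plus (norm (f x)))"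
proof -
  have "continuous_on S (\<lambda>x. ln (max 1 (norm (f x))))"
    by (intro continuous_intros assms) (auto simp: max_def)
  then show ?thesis
    by (simp add: log_plus_eq_ln_max)
qed

text \<open>Conjugating a product keeps its real part, so \<open>a * cnj (poly B w)\<close> may be
  traded for \<open>cnj a * poly B w\<close>. In the product of the two tails the factor
  \<open>w * cnj w = 1\<close> disappears, and the induction hypothesis takes over.\<close>

lemma Re_mult_cnj_polynomial_on_circle:
  "\<exists>C. \<forall>w. norm w = 1 \<longrightarrow> Re (poly A w * cnj (poly B w)) = Re (poly C w)"
proof (induction A arbitrary: B)
  case 0
  show ?case by (rule exI[of _ 0]) auto
next
  case (pCons a A)
  obtain b B' where B: "B = pCons b B'"
    by (cases B)
  obtain C where C: "\<And>w. norm w = 1 \<Longrightarrow> Re (poly A w * cnj (poly B' w)) = Re (poly C w)"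
    using pCons.IH by blast
  have "Re (poly (pCons a A) w * cnj (poly B w))
        = Re (poly (smult (cnj a) B + smult (cnj b) (pCons 0 A) + C) w)" if w: "norm w = 1" for w
  proof -
    have ww: "w * cnj w = 1"
      using w by (simp add: complex_norm_square[symmetric])
    have "poly (pCons a A) w * cnj (poly B w)
      = a * cnj (poly B w) + cnj b * w * poly A w + (w * cnj w) * (poly A w * cnj (poly B' w))"
      by (simp add: B algebra_simps)
    also have "Re \<dots> = Re (cnj a * poly B w) + Re (cnj b * w * poly A w) + Re (poly C w)"
      using C[OF w] unfolding ww by simp
    finally show ?thesis
      by (simp add: algebra_simps)
  qed
  then show ?case by blast
qed

text \<open>On the unit circle a real polynomial in \<open>Re w\<close> and \<open>Im w\<close> is a trigonometric polynomial,
  and these are exactly the real parts of complex polynomials.\<close>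
lemma real_polynomial_function_circle:
  assumes "real_polynomial_function (f :: complex \<Rightarrow> real)"
  shows "\<exists>P. \<forall>w. norm w = 1 \<longrightarrow> f w = Re (poly P w)"
  using assms
proof (induction rule: real_polynomial_function.induct)
  case (linear f)
  interpret bounded_linear f by fact
  have "f w = Re (poly [:0, Complex (f 1) (- f \<i>):] w)" for w
  proof -
    have "w = Re w *\<^sub>R 1 + Im w *\<^sub>R \<i>"
      by (simp add: complex_eq_iff)
    then have "f w = f (Re w *\<^sub>R 1 + Im w *\<^sub>R \<i>)"
      by (rule arg_cong)
    also have "\<dots> = Re w * f 1 + Im w * f \<i>"
      by (simp only: add scale real_scaleR_def)
    finally have "f w = Re w * f 1 + Im w * f \<i>" .
    then show ?thesis by simp
  qed
  then show ?case by blast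
next
  case (const c)
  show ?case by (rule exI[of _ "[:of_real c:]"]) auto
next
  case (add f g)
  then obtain A B where "\<forall>w. norm w = 1 \<longrightarrow> f w = Re (poly A w)"
    "\<forall>w. norm w = 1 \<longrightarrow> g w = Re (poly B w)" by blast
  then have "\<forall>w. norm w = 1 \<longrightarrow> f w + g w = Re (poly (A + B) w)"
    by simp
  then show ?case by blast
next
  case (mult f g)
  then obtain A B where AB: "\<And>w. norm w = 1 \<Longrightarrow> f w = Re (poly A w)"
    "\<And>w. norm w = 1 \<Longrightarrow> g w = Re (poly B w)" by blast
  obtain C where C: "\<And>w. norm w = 1 \<Longrightarrow> Re (poly A w * cnj (poly B w)) = Re (poly C w)"
    using Re_mult_cnj_polynomial_on_circle by blast
  \<comment> \<open>This is Re u * Re v = (Re (u v) + Re (u * cnj v)) / 2; the second term is again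
    the real part of a polynomial on the circle.\<close>
  have "f w * g w = Re (poly (smult (1/2) (A * B + C)) w)" if w: "norm w = 1" for w
  proof -
    have "f w * g w = (Re (poly A w * poly B w) + Re (poly A w * cnj (poly B w))) / 2"
      using AB[OF w] by simp
    then show ?thesis
      using C[OF w] by simp
  qed
  then show ?case by blast
qed

lemma norm_mult_exp_minus_le_1_iff:
  "norm (a * exp (- b)) \<le> 1 \<longleftrightarrow> norm a \<le> exp (Re b)" for a b :: complex
  by (simp add: norm_mult norm_exp_eq_Re exp_minus inverse_eq_divide norm_divide pos_divide_le_eq)

lemma mean_value_circle:
  assumes "P holomorphic_on UNIV"
  shows "((\<lambda>\<theta>. Re (P (cis \<theta>))) has_integral 2 * pi * Re (P 0)) {0..2 * pi}"
proof -
  have "((\<lambda>u. P u / (u - 0)) has_contour_integral (2 * of_real pi * \<i> * P 0)) (circlepath 0 1)"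
    by (rule Cauchy_integral_circlepath_simple) (use assms in \<open>auto intro: holomorphic_on_subset\<close>)
  then have "((\<lambda>t. P (cis t) / cis t * \<i> * cis t) has_integral (2 * of_real pi * \<i> * P 0)) {0..2 * pi}"
    unfolding circlepath_def by (subst (asm) has_contour_integral_part_circlepath_iff) simp_all
  \<comment> \<open>Cauchy's formula carries a factor \<open>\<i>\<close> on both sides, so its
    imaginary part is the mean value property of Re P.\<close>
  then have "((\<lambda>t. Im (P (cis t) * \<i>)) has_integral Im (2 * of_real pi * \<i> * P 0)) {0..2 * pi}"
    by (intro has_integral_Im) simp
  then show ?thesis by simp
qed

text \<open>The map v -> (v - a) / (v + cnj a) sends the right half-plane into the unit disc and a
  to 0, so the Schwarz lemma applies to \<open>q\<close>.\<close>

lemma Harnack_inequality_Re: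
  assumes hol: "P holomorphic_on ball 0 1" and pos: "\<And>z. norm z < 1 \<Longrightarrow> 0 < Re (P z)"
    and z: "norm z < 1"
  shows "Re (P z) \<le> (1 + norm z) / (1 - norm z) * Re (P 0)"
proof -
  define a where "a = P 0"
  define q where "q = (\<lambda>w. (P w - a) / (P w + cnj a))"
  have a: "0 < Re a"
    using pos[of 0] by (simp add: a_def)
  have nz: "P w + cnj a \<noteq> 0" if "norm w < 1" for w
  proof -
    have "0 < Re (P w + cnj a)" using pos[OF that] a by simp
    then show ?thesis by force
  qed
  have "norm (q z) \<le> norm z"
  proof (rule Schwarz_Lemma(1))
    show "q holomorphic_on ball 0 1"
      unfolding q_def using nz by (intro holomorphic_intros hol) auto
    show "q 0 = 0" by (simp add: q_def a_def)
    show "norm (q w) < 1" if "norm w < 1" for w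
    proof -
      have "(Re (P w) - Re a)\<^sup>2 < (Re (P w) + Re a)\<^sup>2"
        using pos[OF that] a by (simp add: power2_eq_square algebra_simps)
      then have "norm (P w - a) < norm (P w + cnj a)"
        by (simp add: cmod_def)
      then show ?thesis
        using nz[OF that] by (simp add: q_def norm_divide)
    qed
  qed (rule z)
  then have "norm (P z - a) \<le> norm z * norm (P z + cnj a)"
    using nz[OF z] by (simp add: q_def norm_divide field_simps)
  then have "(norm (P z - a))\<^sup>2 \<le> (norm z * norm (P z + cnj a))\<^sup>2"
    by (intro power_mono) auto
  then have "(Re (P z) - Re a)\<^sup>2 + (Im (P z) - Im a)\<^sup>2
      \<le> (norm z)\<^sup>2 * ((Re (P z) + Re a)\<^sup>2 + (Im (P z) - Im a)\<^sup>2)"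
    by (simp add: cmod_power2 power_mult_distrib)
  \<comment> \<open>Both moduli contain the same imaginary term; since \<open>norm z < 1\<close> it
    can be cancelled, leaving an inequality between real parts.\<close>
  moreover have "(norm z)\<^sup>2 * (Im (P z) - Im a)\<^sup>2 \<le> 1 * (Im (P z) - Im a)\<^sup>2"
    using z by (intro mult_right_mono) (auto intro: power_le_one)
  ultimately have "(Re (P z) - Re a)\<^sup>2 \<le> (norm z * (Re (P z) + Re a))\<^sup>2"
    by (subst power_mult_distrib) (simp add: distrib_left[of "(norm z)\<^sup>2"])
  moreover have "0 \<le> norm z * (Re (P z) + Re a)"
    using pos[OF z] a by simp
  ultimately have "Re (P z) - Re a \<le> norm z * (Re (P z) + Re a)"
    by (rule power2_le_imp_le)
  then have "Re (P z) * (1 - norm z) \<le> (1 + norm z) * Re a"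
    by (simp add: algebra_simps)
  then show ?thesis
    using z by (simp add: a_def pos_le_divide_eq)
qed

text \<open>A Poisson--Jensen type bound obtained without looking at zeros: \<open>log\<^sup>+|f|\<close> is majorised on
  the circle by \<open>Re P\<close> with \<open>P\<close> a polynomial, the maximum principle for \<open>f * exp (- P)\<close> on
  \<open>{|f| > 1}\<close> carries this into the disc, and Harnack's inequality bounds \<open>Re P\<close>.\<close>
lemma log_plus_norm_le_proximity_fun:
  assumes hol: "f holomorphic_on UNIV" and z: "norm z < R"
  shows "log_plus (norm (f z)) \<le> (R + norm z) / (R - norm z) * proximity_fun f R"
proof -
  have R: "0 < R" using z norm_ge_zero le_less_trans by blast
  define F where "F = (\<lambda>w. f (of_real R * w))"
  define u where "u = (\<lambda>w. log_plus (norm (F w)))"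
  have holF: "F holomorphic_on S" for S
    unfolding F_def
    by (rule holomorphic_on_compose_gen[OF _ hol, unfolded o_def]) (auto intro!: holomorphic_intros)
  have contF: "continuous_on S F" for S
    using holF holomorphic_on_imp_continuous_on by blast
  have contu: "continuous_on S u" for S
    unfolding u_def by (intro continuous_intros contF)
  have majorant: "u w \<le> (1 + norm w) / (1 - norm w) * (proximity_fun f R + 3 * e)"
    if w: "norm w < 1" and e: "0 < e" for w e
  proof -
    \<comment> \<open>Approximating \<open>u + 2 * e\<close> within \<open>e\<close> places the
      majorant between \<open>u + e\<close> and \<open>u + 3 * e\<close>; the lower gap keeps Re P
      strictly positive, as Harnack's inequality requires.\<close>
    obtain g where g: "real_polynomial_function g"
      "\<And>x. x \<in> sphere 0 1 \<Longrightarrow> \<bar>(u x + 2 * e) - g x\<bar> < e"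
      by (rule Stone_Weierstrass_real_polynomial_function[of "sphere 0 1" "\<lambda>x. u x + 2 * e" e])
        (use e in \<open>auto intro!: continuous_intros contu\<close>)
    obtain Q where Q: "\<And>x. norm x = 1 \<Longrightarrow> g x = Re (poly Q x)"
      using real_polynomial_function_circle[OF g(1)] by blast
    define P where "P = poly Q"
    have holP: "P holomorphic_on S" for S
      unfolding P_def by (intro holomorphic_intros)
    have contP: "continuous_on S P" for S
      using holP holomorphic_on_imp_continuous_on by blast
    have lower: "u x + e \<le> Re (P x)" and upper: "Re (P x) \<le> u x + 3 * e" if "norm x = 1" for x
      using g(2)[of x] Q[of x] that by (auto simp: P_def abs_less_iff)
    have Ppos: "e \<le> Re (P x)" if "norm x < 1" for x
    proof -
      have "Re (- P x) \<le> - e"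
      proof (rule maximum_real_frontier[where f = "\<lambda>x. - P x" and S = "ball 0 1"])
        show "Re (- P y) \<le> - e" if "y \<in> frontier (ball 0 1)" for y
          using lower[of y] that log_plus_nonneg[of "norm (F y)"] unfolding u_def
            by (simp del: log_plus_nonneg)
      qed (use that in \<open>auto intro!: holomorphic_intros holP continuous_intros contP\<close>)
      then show ?thesis by simp
    qed
    have uP: "u w \<le> Re (P w)"
    proof (cases "norm (F w) \<le> 1")
      case True
      then have "u w = 0" by (simp add: u_def log_plus_eq_ln_max max_def)
      then show ?thesis using Ppos[OF w] e by simp
    next
      case False
      define S where "S = ball 0 1 \<inter> {x. 1 < norm (F x)}"
      have "open S"
        unfolding S_def by (intro open_Int open_Collect_less continuous_intros contF) auto
      have clS: "closure S \<subseteq> cball 0 1 \<inter> {x. 1 \<le> norm (F x)}"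
        by (rule closure_minimal)
          (auto simp: S_def intro!: closed_Int closed_Collect_le continuous_intros contF)
      have "norm (F w * exp (- P w)) \<le> 1"
      proof (rule maximum_modulus_frontier[where f = "\<lambda>x. F x * exp (- P x)" and S = S])
        show "(\<lambda>x. F x * exp (- P x)) holomorphic_on interior S"
          by (intro holomorphic_intros holF holP)
        show "continuous_on (closure S) (\<lambda>x. F x * exp (- P x))"
          by (intro continuous_intros contF contP)
        show "bounded S" unfolding S_def by auto
        show "w \<in> S" using False w by (auto simp: S_def)
        \<comment> \<open>A frontier point lies on the unit circle, where Re P majorises
          \<open>u\<close>, or inside it with |F| = 1, where Re P > 0 suffices.\<close>
        show "norm (F x * exp (- P x)) \<le> 1" if x: "x \<in> frontier S" for x
        proof -
          have x': "norm x \<le> 1" "1 \<le> norm (F x)" "x \<notin> S"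
            using x clS \<open>open S\<close> by (auto simp: frontier_def interior_open)
          have "ln (norm (F x)) \<le> Re (P x)"
          proof (cases "norm x = 1")
            case True
            then show ?thesis
              using lower[of x] e x' by (auto simp: u_def log_plus_def)
          next
            case False
            then have "norm (F x) = 1" using x' by (auto simp: S_def)
            then show ?thesis using Ppos[of x] e x' False by simp
          qed
          moreover have "0 < norm (F x)" using x'(2) by linarith
          ultimately have "norm (F x) \<le> exp (Re (P x))"
            by (metis exp_le_cancel_iff exp_ln)
          then show ?thesis
            by (simp add: norm_mult_exp_minus_le_1_iff)
        qed
      qed
      then have "norm (F w) \<le> exp (Re (P w))"
        by (simp add: norm_mult_exp_minus_le_1_iff)
      then show ?thesis
        using False Ppos[OF w] e ln_mono[of "norm (F w)" "exp (Re (P w))"]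
        by (cases "F w = 0") (auto simp: u_def log_plus_def)
    qed
    have "continuous_on {0..2 * pi} (\<lambda>\<theta>. u (cis \<theta>))"
      by (rule continuous_on_compose2[OF contu[of UNIV] continuous_on_cis[OF continuous_on_id]]) simp
    then have intu: "(\<lambda>\<theta>. u (cis \<theta>)) integrable_on {0..2 * pi}"
      by (rule integrable_continuous_interval)
    then have int: "(\<lambda>\<theta>. u (cis \<theta>) + 3 * e) integrable_on {0..2 * pi}"
      by (intro integrable_add) auto
    have "2 * pi * Re (P 0) \<le> integral {0..2 * pi} (\<lambda>\<theta>. u (cis \<theta>) + 3 * e)"
      by (rule has_integral_le[OF mean_value_circle[OF holP] integrable_integral[OF int]])
        (use upper in auto)
    also have "\<dots> = integral {0..2 * pi} (\<lambda>\<theta>. u (cis \<theta>)) + 2 * pi * (3 * e)"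
      by (subst integral_add[OF intu]) auto
    also have "integral {0..2 * pi} (\<lambda>\<theta>. u (cis \<theta>)) = 2 * pi * proximity_fun f R"
      by (simp add: proximity_fun_def u_def F_def)
    finally have "2 * pi * Re (P 0) \<le> 2 * pi * (proximity_fun f R + 3 * e)"
      by (simp add: distrib_left)
    then have P0: "Re (P 0) \<le> proximity_fun f R + 3 * e"
      using pi_gt_zero by (simp only: mult_le_cancel_left_pos mult_pos_pos zero_less_numeral)
    have "Re (P w) \<le> (1 + norm w) / (1 - norm w) * Re (P 0)"
      by (rule Harnack_inequality_Re[OF holP less_le_trans[OF e Ppos] w])
    with uP have "u w \<le> (1 + norm w) / (1 - norm w) * Re (P 0)"
      by (rule order_trans)
    also have "\<dots> \<le> (1 + norm w) / (1 - norm w) * (proximity_fun f R + 3 * e)"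
      using P0 w by (intro mult_left_mono) auto
    finally show ?thesis .
  qed
  define w where "w = z / of_real R"
  have w: "norm w < 1" "norm w = norm z / R"
    using z R by (auto simp: w_def norm_divide)
  have "u w \<le> (1 + norm w) / (1 - norm w) * proximity_fun f R"
  proof (rule field_le_epsilon)
    fix d :: real
    assume d: "0 < d"
    define c where "c = (1 + norm w) / (1 - norm w)"
    have c: "0 < c" using w norm_ge_zero[of w] by (simp add: c_def add_pos_nonneg)
    \<comment> \<open>With \<open>e = d / (3 * c)\<close> the error \<open>3 * e\<close>, multiplied
      by the Harnack factor \<open>c\<close>, is exactly \<open>d\<close>.\<close>
    show "u w \<le> (1 + norm w) / (1 - norm w) * proximity_fun f R + d"
      using majorant[OF w(1), of "d / (3 * c)"] c d
      unfolding c_def[symmetric] by (simp add: distrib_left)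
  qed
  moreover have "(1 + norm w) / (1 - norm w) = (R + norm z) / (R - norm z)"
    using R z by (simp add: w field_simps)
  moreover have "F w = f z"
    using R by (simp add: F_def w_def)
  ultimately show ?thesis
    by (simp add: u_def)
qed

section \<open>Maximum modulus and characteristic\<close>

lemma entire_bdd_above_sphere:
  assumes "g holomorphic_on UNIV"
  shows "bdd_above ((\<lambda>z. norm (g z)) ` sphere 0 r)"
proof -
  have "continuous_on (sphere 0 r) (\<lambda>z. norm (g z))"
    using assms by (intro continuous_on_norm holomorphic_on_imp_continuous_on)
      (auto intro: holomorphic_on_subset)
  then show ?thesis
    by (intro bounded_imp_bdd_above compact_imp_bounded compact_continuous_image) auto
qed

lemma norm_le_max_modulus_sphere:
  assumes "g holomorphic_on UNIV" "norm z = r"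
  shows "norm (g z) \<le> max_modulus g r"
  unfolding max_modulus_def
  by (rule cSUP_upper) (use assms entire_bdd_above_sphere in auto)

lemma max_modulus_le:
  assumes "0 \<le> r" "\<And>z. norm z = r \<Longrightarrow> norm (g z) \<le> B"
  shows "max_modulus g r \<le> B"
  unfolding max_modulus_def by (rule cSUP_least) (use assms in auto)

lemma max_modulus_attained:
  assumes "g holomorphic_on UNIV" "0 \<le> r"
  obtains z where "norm z = r" "max_modulus g r = norm (g z)"
proof -
  have "continuous_on (sphere 0 r) (\<lambda>z. norm (g z))"
    using assms(1) by (intro continuous_on_norm holomorphic_on_imp_continuous_on)
      (auto intro: holomorphic_on_subset)
  then obtain z where "z \<in> sphere 0 r" "\<And>w. w \<in> sphere 0 r \<Longrightarrow> norm (g w) \<le> norm (g z)"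
    using continuous_attains_sup[OF compact_sphere] assms(2) by (metis sphere_eq_empty not_le)
  then show ?thesis
    using that[of z] max_modulus_le[OF assms(2), of g "norm (g z)"]
      norm_le_max_modulus_sphere[OF assms(1), of z r] by force
qed

lemma norm_le_max_modulus:
  assumes g: "g holomorphic_on UNIV" and z: "norm z \<le> r"
  shows "norm (g z) \<le> max_modulus g r"
proof (rule maximum_modulus_frontier[where f = g and S = "cball 0 r"])
  show "continuous_on (closure (cball 0 r)) g"
    using g by (intro holomorphic_on_imp_continuous_on) (auto intro: holomorphic_on_subset)
  show "norm (g w) \<le> max_modulus g r" if "w \<in> frontier (cball 0 r)" for w
    using that g by (intro norm_le_max_modulus_sphere) auto
qed (use assms in \<open>auto intro: holomorphic_on_subset\<close>)

lemma max_modulus_mono: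
  assumes "g holomorphic_on UNIV" "0 \<le> r" "r \<le> s"
  shows "max_modulus g r \<le> max_modulus g s"
  using assms by (intro max_modulus_le norm_le_max_modulus) auto

lemma max_modulus_nonneg:
  assumes "g holomorphic_on UNIV" "0 \<le> r"
  shows "0 \<le> max_modulus g r"
  using max_modulus_attained[OF assms] by (metis norm_ge_zero)

lemma filterlim_max_modulus_at_top:
  assumes "nonconstant_entire g"
  shows "filterlim (max_modulus g) at_top at_top"
  unfolding filterlim_at_top
proof
  fix B
  have g: "g holomorphic_on UNIV" "\<not> g constant_on UNIV"
    using assms by (auto simp: nonconstant_entire_def)
  then have "\<not> bounded (range g)"
    using Liouville_theorem by blast
  then obtain z where z: "B < norm (g z)"
    unfolding bounded_iff by (metis not_le rangeE)
  have "B \<le> max_modulus g r" if "norm z \<le> r" for r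
    using norm_le_max_modulus[OF g(1) that] z by simp
  then show "\<forall>\<^sub>F r in at_top. B \<le> max_modulus g r"
    using eventually_ge_at_top by (rule eventually_mono[rotated])
qed

lemma nevanlinna_T_eq_proximity_fun:
  assumes "\<And>z. \<not> is_pole f z"
  shows "nevanlinna_T f = proximity_fun f"
proof -
  have "pole_count f t = 0" for t
    using assms by (simp add: pole_count_def)
  then show ?thesis
    by (intro ext) (simp add: nevanlinna_T_def counting_fun_def)
qed

lemma nevanlinna_T_entire:
  assumes "g holomorphic_on UNIV"
  shows "nevanlinna_T g = proximity_fun g"
  by (rule nevanlinna_T_eq_proximity_fun) (use assms not_is_pole_holomorphic in blast)

text \<open>Joint continuity in radius and angle is what makes the circle mean continuous in the
  radius.\<close>

lemma continuous_on_circle_param: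
  assumes "g holomorphic_on UNIV"
  shows "continuous_on S (\<lambda>x. log_plus (norm (g (of_real (fst x) * cis (snd x)))))"
proof -
  have "continuous_on UNIV g"
    using assms by (rule holomorphic_on_imp_continuous_on)
  moreover have "continuous_on S (\<lambda>x. of_real (fst x) * cis (snd x) :: complex)"
    by (intro continuous_intros)
  ultimately have "continuous_on S (\<lambda>x. g (of_real (fst x) * cis (snd x)))"
    by (rule continuous_on_compose2) simp
  then show ?thesis
    by (rule continuous_on_log_plus_norm)
qed

lemma continuous_on_circle:
  assumes "g holomorphic_on UNIV"
  shows "continuous_on S (\<lambda>\<theta>. log_plus (norm (g (of_real r * cis \<theta>))))"
  by (rule continuous_on_compose2[OF continuous_on_circle_param[OF assms, of UNIV],
        where f = "\<lambda>\<theta>. (r, \<theta>)", simplified])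
    (intro continuous_intros)

lemma continuous_on_proximity_fun:
  assumes "g holomorphic_on UNIV"
  shows "continuous_on S (proximity_fun g)"
proof -
  have "continuous_on S (\<lambda>r. integral (cbox 0 (2 * pi)) (\<lambda>\<theta>. log_plus (norm (g (of_real r * cis \<theta>)))))"
    using continuous_on_circle_param[OF assms]
    by (intro integral_continuous_on_param) (simp add: case_prod_beta)
  then show ?thesis
    unfolding proximity_fun_def[abs_def] by (intro continuous_on_mult_left) simp
qed

lemma proximity_fun_le_log_plus_max_modulus:
  assumes "g holomorphic_on UNIV" "0 \<le> r"
  shows "proximity_fun g r \<le> log_plus (max_modulus g r)"
proof -
  have "integral {0..2 * pi} (\<lambda>\<theta>. log_plus (norm (g (of_real r * cis \<theta>))))
      \<le> integral {0..2 * pi} (\<lambda>\<theta>. log_plus (max_modulus g r))"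
  proof (rule integral_le)
    show "(\<lambda>\<theta>. log_plus (norm (g (of_real r * cis \<theta>)))) integrable_on {0..2 * pi}"
      by (intro integrable_continuous_interval continuous_on_circle assms)
    show "log_plus (norm (g (of_real r * cis \<theta>))) \<le> log_plus (max_modulus g r)" for \<theta>
      using assms by (intro log_plus_mono norm_le_max_modulus) (auto simp: norm_mult)
  qed (intro integrable_continuous_interval continuous_on_const)
  then show ?thesis
    by (simp add: proximity_fun_def field_simps)
qed

lemma log_plus_max_modulus_le_proximity_fun:
  assumes g: "g holomorphic_on UNIV" and r: "0 \<le> r" "r < R"
  shows "log_plus (max_modulus g r) \<le> (R + r) / (R - r) * proximity_fun g R"
proof -
  obtain z where z: "norm z = r" "max_modulus g r = norm (g z)"
    using max_modulus_attained[OF g r(1)] .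
  show ?thesis
    using log_plus_norm_le_proximity_fun[OF g, of z R] z r by simp
qed

lemma filterlim_log_plus_at_top: "filterlim log_plus at_top at_top"
  unfolding log_plus_def
  by (rule filterlim_at_top_mono[OF ln_at_top]) auto

lemma filterlim_nevanlinna_T_at_top:
  assumes "nonconstant_entire g"
  shows "filterlim (nevanlinna_T g) at_top at_top"
proof -
  have g: "g holomorphic_on UNIV"
    using assms by (simp add: nonconstant_entire_def)
  \<comment> \<open>At the radius r = R / 2 the factor (R + r) / (R - r) equals 3.\<close>
  have "filterlim (\<lambda>R. 1 / 3 * log_plus (max_modulus g (1 / 2 * R))) at_top at_top"
    by (intro filterlim_tendsto_pos_mult_at_top[OF tendsto_const] filterlim_ident
        filterlim_compose[OF filterlim_log_plus_at_top]
        filterlim_compose[OF filterlim_max_modulus_at_top[OF assms]]) auto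
  moreover have "1 / 3 * log_plus (max_modulus g (1 / 2 * R)) \<le> nevanlinna_T g R" if "0 < R" for R
    using log_plus_max_modulus_le_proximity_fun[OF g, of "1 / 2 * R" R] that
    by (simp add: nevanlinna_T_entire[OF g] field_simps)
  ultimately show ?thesis
    by (elim filterlim_at_top_mono) (auto intro: eventually_mono[OF eventually_gt_at_top[of 0]])
qed

text \<open>The intermediate value theorem, applied between 1 and a radius where the characteristic
  exceeds s, gives a positive preimage. These two properties are all that later estimates use about
  the inverse.\<close>

lemma nevanlinna_T_inv_entire:
  assumes "nonconstant_entire g"
  shows "\<forall>\<^sub>F s in at_top. 0 < nevanlinna_T_inv g s \<and> nevanlinna_T g (nevanlinna_T_inv g s) = s"
  using eventually_ge_at_top[of "nevanlinna_T g 1"]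
proof eventually_elim
  case (elim s)
  have g: "g holomorphic_on UNIV"
    using assms by (simp add: nonconstant_entire_def)
  obtain R where R: "1 \<le> R" "s \<le> nevanlinna_T g R"
    using filterlim_nevanlinna_T_at_top[OF assms]
    unfolding filterlim_at_top eventually_at_top_linorder by (metis linear)
  have "\<exists>x\<ge>1. x \<le> R \<and> nevanlinna_T g x = s"
    using elim R continuous_on_proximity_fun[OF g]
    by (intro IVT') (auto simp: nevanlinna_T_entire[OF g])
  then have "s \<in> nevanlinna_T g ` {0<..}"
    by force
  then show ?case
    using inv_into_into[of s "nevanlinna_T g" "{0<..}"] f_inv_into_f[of s "nevanlinna_T g" "{0<..}"]
    by (simp add: nevanlinna_T_inv_def)
qed

text \<open>If the preimage R of s stayed below B, then s = T(R) would be bounded by the fixed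
  number log_plus M(B).\<close>

lemma filterlim_nevanlinna_T_inv_at_top:
  assumes "nonconstant_entire g"
  shows "filterlim (nevanlinna_T_inv g) at_top at_top"
  unfolding filterlim_at_top
proof
  fix B :: real
  have g: "g holomorphic_on UNIV"
    using assms by (simp add: nonconstant_entire_def)
  show "\<forall>\<^sub>F s in at_top. B \<le> nevanlinna_T_inv g s"
    using nevanlinna_T_inv_entire[OF assms]
      eventually_gt_at_top[of "log_plus (max_modulus g (max 0 B))"]
  proof eventually_elim
    case (elim s)
    define R where "R = nevanlinna_T_inv g s"
    have R: "0 < R" "proximity_fun g R = s"
      using elim by (auto simp: R_def nevanlinna_T_entire[OF g])
    show ?case
    proof (rule ccontr)
      assume "\<not> B \<le> nevanlinna_T_inv g s"
      then have "log_plus (max_modulus g R) \<le> log_plus (max_modulus g (max 0 B))"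
        using R by (intro log_plus_mono max_modulus_mono g max_modulus_nonneg) (auto simp: R_def)
      then show False
        using proximity_fun_le_log_plus_max_modulus[OF g, of R] R elim by simp
    qed
  qed
qed

text \<open>A weak form of Hadamard's three circles theorem for the radii \<open>1 < r < r\<^sup>a\<close>:
  with \<open>m / n\<close> strictly between \<open>ln M(r) / (2 ln r)\<close> and \<open>(ln M(r) - ln M(1)) / ln r\<close>, the
  maximum principle for \<open>g\<^sup>n / z\<^sup>m\<close> on the annulus excludes a smaller value of \<open>M(r\<^sup>a)\<close>.\<close>
lemma ln_max_modulus_powr_ge:
  assumes g: "nonconstant_entire g" and a: "1 < a"
  shows "\<forall>\<^sub>F r in at_top.
    (1 + (a - 1) / 2) * ln (max_modulus g r) \<le> ln (max_modulus g (r powr a))"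
proof -
  have hol: "g holomorphic_on UNIV"
    using g by (simp add: nonconstant_entire_def)
  define M where "M = max_modulus g"
  define C where "C = ln (max 1 (M 1))"
  have C: "0 \<le> C" "M 1 \<le> exp C"
    by (auto simp: C_def)
  have "filterlim (\<lambda>r. ln (M r)) at_top at_top"
    unfolding M_def by (intro filterlim_compose[OF ln_at_top] filterlim_max_modulus_at_top g)
  \<comment> \<open>This makes the interval from L / 2 to L - C nonempty, which leaves room for the
    exponent \<open>q\<close>.\<close>
  then have "\<forall>\<^sub>F r in at_top. 2 * C < ln (M r)"
    by (simp add: filterlim_at_top_dense)
  moreover have "\<forall>\<^sub>F r in at_top. 1 < M r"
    using filterlim_max_modulus_at_top[OF g] by (simp add: filterlim_at_top_dense M_def)
  ultimately show ?thesis
    using eventually_gt_at_top[of 1] unfolding M_def[symmetric]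
  proof eventually_elim
    case (elim r)
    define L where "L = ln (M r)"
    define R where "R = r powr a"
    have l: "0 < ln r" using elim by simp
    have rR: "r < R"
      using powr_less_mono[of 1 a r] a elim by (simp add: R_def)
    then have MR: "M r \<le> M R"
      unfolding M_def using elim by (intro max_modulus_mono hol) auto
    show ?case
    proof (rule ccontr)
      assume "\<not> ?thesis"
      then have less: "ln (M R) < (1 + (a - 1) / 2) * L"
        by (simp add: L_def R_def)
      have "L / 2 / ln r < (L - C) / ln r"
        using elim l by (intro divide_strict_right_mono) (auto simp: L_def)
      \<comment> \<open>A rational exponent m / n lets the single-valued function g^n / z^m stand in
        for g / z^q.\<close>
      then obtain q where q: "q \<in> \<rat>" "L / 2 / ln r < q" "q < (L - C) / ln r"
        using Rats_dense_in_real by blast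
      have "0 < q"
        using q(2) l elim C by (intro less_trans[OF _ q(2)]) (auto simp: L_def)
      then obtain m n :: nat where mn: "n \<noteq> 0" "q = m / n"
        using Rats_abs_nat_div_natE[OF q(1)] by (metis abs_of_pos)
      have lo: "L / 2 < q * ln r" and hi: "C < L - q * ln r"
        using q l by (auto simp: field_simps)
      \<comment> \<open>The larger of the bounds for ln |g| - q ln |z| on the circles of radius 1
        and R.\<close>
      define b where "b = max C (ln (M R) - q * ln R)"
      have "L - q * ln r \<le> b"
      proof -
        obtain z where z: "norm z = r" "M r = norm (g z)"
          unfolding M_def using max_modulus_attained[OF hol, of r] elim by auto
        define S :: "complex set" where "S = ball 0 R \<inter> {z. 1 < norm z}"
        have nz: "w \<noteq> 0" if "w \<in> closure S" for w
        proof -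
          have "closure S \<subseteq> {w. 1 \<le> norm w}"
            by (rule closure_minimal) (auto simp: S_def intro!: closed_Collect_le continuous_intros)
          then show ?thesis using that by auto
        qed
        have "norm (g z ^ n / z ^ m) \<le> exp (n * b)"
        proof (rule maximum_modulus_frontier[where f = "\<lambda>w. g w ^ n / w ^ m" and S = S])
          have "w ^ m \<noteq> 0" if "w \<in> interior S" for w
            using that nz interior_subset closure_subset by (metis power_not_zero subsetD)
          then show "(\<lambda>w. g w ^ n / w ^ m) holomorphic_on interior S"
            by (intro holomorphic_on_divide holomorphic_on_power holomorphic_on_subset[OF hol]
                holomorphic_on_ident) auto
          show "continuous_on (closure S) (\<lambda>w. g w ^ n / w ^ m)"
            using nz by (intro continuous_on_divide continuous_on_power continuous_on_id
                holomorphic_on_imp_continuous_on holomorphic_on_subset[OF hol]) auto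
          show "bounded S" unfolding S_def by auto
          show "z \<in> S" using z elim rR by (auto simp: S_def)
          show "norm (g w ^ n / w ^ m) \<le> exp (n * b)" if w: "w \<in> frontier S" for w
          proof -
            have "open S"
              unfolding S_def by (intro open_Int open_Collect_less continuous_intros) auto
            then have "w \<notin> S" using w by (simp add: frontier_def interior_open)
            moreover have "closure S \<subseteq> cball 0 R \<inter> {w. 1 \<le> norm w}"
              by (rule closure_minimal)
                (auto simp: S_def intro!: closed_Int closed_Collect_le continuous_intros)
            ultimately have "norm w = 1 \<or> norm w = R"
              using w by (auto simp: S_def frontier_def)
            then show ?thesis
            proof
              assume w1: "norm w = 1"
              have "norm (g w) \<le> exp C"
                using norm_le_max_modulus_sphere[OF hol w1] C by (simp add: M_def)
              also have "\<dots> \<le> exp b" by (simp add: b_def)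
              finally have "norm (g w) ^ n \<le> exp b ^ n" by (rule power_mono) simp
              then show ?thesis
                using w1 by (simp add: norm_divide norm_power exp_of_nat_mult)
            next
              assume w2: "norm w = R"
              have R0: "0 < R" and MR0: "0 < M R" using rR elim MR by auto
              have "norm (g w) \<le> exp (ln (M R))"
                using norm_le_max_modulus_sphere[OF hol w2] MR0 by (simp add: M_def)
              then have "norm (g w) ^ n \<le> exp (ln (M R)) ^ n" by (rule power_mono) simp
              then have "norm (g w ^ n / w ^ m) \<le> exp (ln (M R)) ^ n / exp (ln R) ^ m"
                using w2 R0 by (simp add: norm_divide norm_power divide_right_mono)
              also have "\<dots> = exp (n * ln (M R) - m * ln R)"
                by (simp only: exp_of_nat_mult exp_diff)
              also have "n * ln (M R) - m * ln R = n * (ln (M R) - q * ln R)"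
                using mn by (simp add: field_simps)
              also have "exp \<dots> \<le> exp (n * b)"
                by (simp add: b_def mult_left_mono)
              finally show ?thesis .
            qed
          qed
        qed
        moreover have "exp L = norm (g z)"
          using z elim by (subst L_def, subst exp_ln) auto
        then have "norm (g z ^ n / z ^ m) = exp (n * L - m * ln r)"
          using z elim by (simp add: norm_divide norm_power exp_diff exp_of_nat_mult)
        ultimately have "n * L - m * ln r \<le> n * b" by simp
        also have "n * L - m * ln r = n * (L - q * ln r)"
          using mn by (simp add: field_simps)
        finally show ?thesis using mn by simp
      qed
      define x where "x = q * ln r"
      have "ln R = a * ln r"
        using elim by (simp add: R_def ln_powr)
      \<comment> \<open>\<open>hi\<close> rules out that \<open>b\<close> is the inner bound
        \<open>C\<close>, so the outer circle determines it.\<close>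
      with hi \<open>L - q * ln r \<le> b\<close> have "L - x \<le> ln (M R) - a * x"
        by (simp add: b_def x_def max_def mult.left_commute split: if_splits)
      then have "L + (a - 1) * x \<le> ln (M R)"
        by (simp add: algebra_simps)
      also note less
      also have "(1 + (a - 1) / 2) * L = L + (a - 1) * (L / 2)"
        by (simp add: field_simps)
      finally have "(a - 1) * x < (a - 1) * (L / 2)"
        by simp
      then show False
        using lo a by (simp add: x_def)
    qed
  qed
qed

section \<open>Comparison of inverse characteristics and lower orders\<close>

lemma proximity_fun_nonneg: "0 \<le> proximity_fun f r"
proof -
  have "0 \<le> integral {0..2 * pi} (\<lambda>\<theta>. log_plus (norm (f (of_real r * cis \<theta>))))"
    \<comment> \<open>For arbitrary f the integrand may fail to be integrable; the integral then has
      the default value 0.\<close>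
    by (cases "(\<lambda>\<theta>. log_plus (norm (f (of_real r * cis \<theta>)))) integrable_on {0..2 * pi}")
      (auto intro: integral_nonneg simp: not_integrable_integral)
  then show ?thesis
    by (simp add: proximity_fun_def)
qed

text \<open>For r = R^b the factor (R + r) / (R - r) depends only on R^(b - 1), which tends to 0, so
  the factor tends to 1. A fixed factor such as 3 could exceed the gain from the three circles
  estimate.\<close>

lemma log_plus_max_modulus_powr_le:
  assumes g: "nonconstant_entire g" and b: "b < 1" and e: "0 < e"
  shows "\<forall>\<^sub>F R in at_top. log_plus (max_modulus g (R powr b)) \<le> (1 + e) * nevanlinna_T g R"
proof -
  have hol: "g holomorphic_on UNIV"
    using g by (simp add: nonconstant_entire_def)
  have lim: "((\<lambda>R. R powr (b - 1)) \<longlongrightarrow> 0) at_top"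
    using b by (intro tendsto_neg_powr filterlim_ident) simp
  have "((\<lambda>R. (1 + R powr (b - 1)) / (1 - R powr (b - 1))) \<longlongrightarrow> (1 + 0) / (1 - 0)) at_top"
    by (intro tendsto_intros lim) simp
  then have "\<forall>\<^sub>F R in at_top. (1 + R powr (b - 1)) / (1 - R powr (b - 1)) < 1 + e"
    by (rule order_tendstoD) (use e in simp)
  then show ?thesis
    using eventually_gt_at_top[of 1]
  proof eventually_elim
    case (elim R)
    have r: "R powr b = R * R powr (b - 1)"
      using elim by (simp add: powr_diff)
    have "R powr b < R"
      using powr_less_mono[of b 1 R] b elim by simp
    then have "log_plus (max_modulus g (R powr b))
        \<le> (R + R powr b) / (R - R powr b) * proximity_fun g R"
      by (intro log_plus_max_modulus_le_proximity_fun hol) auto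
    also have "(R + R powr b) / (R - R powr b)
        = (R * (1 + R powr (b - 1))) / (R * (1 - R powr (b - 1)))"
      unfolding r by (simp only: distrib_left right_diff_distrib mult_1_right)
    also have "\<dots> = (1 + R powr (b - 1)) / (1 - R powr (b - 1))"
      using elim by (intro mult_divide_mult_cancel_left) simp
    also have "\<dots> * proximity_fun g R \<le> (1 + e) * proximity_fun g R"
      using elim by (intro mult_right_mono proximity_fun_nonneg) simp
    finally show ?case
      by (simp add: nevanlinna_T_entire[OF hol])
  qed
qed

text \<open>If \<open>X\<^sup>\<kappa>\<close> were below both radii on the right, then at radius \<open>X\<^sup>a\<close>, \<open>a = sqrt \<kappa>\<close>, the three
  circles estimate would give \<open>ln M\<^sub>h \<ge> (1 + 2 d) s\<close>, while \<open>M\<^sub>h \<le> M\<^sub>1 + M\<^sub>2\<close> and the sharp form of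
  \<open>ln M(R\<^sup>b) \<le> (1 + o(1)) T(R)\<close> for \<open>b < 1\<close> give \<open>ln M\<^sub>h \<le> ln 2 + (1 + d) s\<close>.\<close>
lemma min_nevanlinna_T_inv_le:
  assumes h: "nonconstant_entire h" and g: "nonconstant_entire g1" "nonconstant_entire g2"
    and le: "\<And>z. norm (h z) \<le> norm (g1 z) + norm (g2 z)" and k: "1 < \<kappa>"
  shows "\<forall>\<^sub>F s in at_top.
    min (nevanlinna_T_inv g1 s) (nevanlinna_T_inv g2 s) \<le> nevanlinna_T_inv h s powr \<kappa>"
proof -
  have hol: "h holomorphic_on UNIV" "g1 holomorphic_on UNIV" "g2 holomorphic_on UNIV"
    using h g by (auto simp: nonconstant_entire_def)
  define a where "a = sqrt \<kappa>"
  have a: "1 < a" "\<kappa> * (1 / a) = a"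
    using k real_sqrt_mult_self[of \<kappa>] by (auto simp: a_def field_simps)
  \<comment> \<open>The three circles gain is \<open>1 + 2 * d\<close>. One \<open>d\<close> pays
    for the o(1) loss in the characteristic; the other leaves \<open>d * s\<close>, which eventually
    beats \<open>ln 2\<close>.\<close>
  define d where "d = (a - 1) / 4"
  have d: "0 < d" and d2: "1 + (a - 1) / 2 = 1 + 2 * d"
    using a by (auto simp: d_def)
  have M: "\<forall>\<^sub>F s in at_top. log_plus (max_modulus g (nevanlinna_T_inv g s powr (1 / a))) \<le> (1 + d) * s"
    if "nonconstant_entire g" for g
  proof -
    have "1 / a < 1" using a by simp
    from eventually_compose_filterlim[OF log_plus_max_modulus_powr_le[OF that this d]
        filterlim_nevanlinna_T_inv_at_top[OF that]] nevanlinna_T_inv_entire[OF that]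
    show ?thesis by eventually_elim simp
  qed
  have H: "\<forall>\<^sub>F s in at_top. (1 + 2 * d) * ln (max_modulus h (nevanlinna_T_inv h s))
      \<le> ln (max_modulus h (nevanlinna_T_inv h s powr a))"
    using eventually_compose_filterlim[OF ln_max_modulus_powr_ge[OF h a(1)]
        filterlim_nevanlinna_T_inv_at_top[OF h]] by (simp add: d2)
  have X: "\<forall>\<^sub>F s in at_top. 1 < nevanlinna_T_inv h s"
    using filterlim_nevanlinna_T_inv_at_top[OF h] by (simp add: filterlim_at_top_dense)
  show ?thesis
    using M[OF g(1)] M[OF g(2)] H X nevanlinna_T_inv_entire[OF h]
      eventually_gt_at_top[of "ln 2 / d"] eventually_gt_at_top[of 0]
  proof eventually_elim
    case (elim s)
    define X where "X = nevanlinna_T_inv h s"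
    show ?case
    proof (rule ccontr)
      assume "\<not> ?thesis"
      then have less: "X powr \<kappa> < nevanlinna_T_inv g1 s" "X powr \<kappa> < nevanlinna_T_inv g2 s"
        by (auto simp: X_def)
      have X1: "1 < X" using elim by (simp add: X_def)
      have bound: "max_modulus g (X powr a) \<le> exp ((1 + d) * s)"
        if "X powr \<kappa> < nevanlinna_T_inv g s" "g holomorphic_on UNIV"
          "log_plus (max_modulus g (nevanlinna_T_inv g s powr (1 / a))) \<le> (1 + d) * s" for g
      proof -
        \<comment> \<open>Since \<open>\<kappa> = a * a\<close>, one factor \<open>a\<close> is
          available for the three circles estimate and the other for the passage from T to
          M.\<close>
        have "X powr a = (X powr \<kappa>) powr (1 / a)"
          by (simp only: powr_powr a(2))
        also have "\<dots> \<le> nevanlinna_T_inv g s powr (1 / a)"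
          using that(1) a by (intro powr_mono2) auto
        finally have "max_modulus g (X powr a) \<le> max_modulus g (nevanlinna_T_inv g s powr (1 / a))"
          by (intro max_modulus_mono that) auto
        also have "\<dots> \<le> exp (log_plus (max_modulus g (nevanlinna_T_inv g s powr (1 / a))))"
          by (subst log_plus_eq_ln_max) (auto intro!: max_modulus_nonneg that)
        also have "\<dots> \<le> exp ((1 + d) * s)"
          using that by simp
        finally show ?thesis .
      qed
      have "max_modulus h (X powr a) \<le> max_modulus g1 (X powr a) + max_modulus g2 (X powr a)"
        by (intro max_modulus_le order_trans[OF le] add_mono norm_le_max_modulus_sphere hol) auto
      also have "\<dots> \<le> exp ((1 + d) * s) + exp ((1 + d) * s)"
        using elim less hol by (intro add_mono bound) auto
      finally have up: "max_modulus h (X powr a) \<le> 2 * exp ((1 + d) * s)"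
        by simp
      have "s \<le> log_plus (max_modulus h X)"
        using proximity_fun_le_log_plus_max_modulus[OF hol(1), of X] elim X1
        by (simp add: X_def nevanlinna_T_entire[OF hol(1)])
      then have s: "s \<le> ln (max_modulus h X)"
        using elim by (simp add: log_plus_def)
      then have "0 < ln (max_modulus h X)" using elim by simp
      then have pos: "0 < max_modulus h X"
        using max_modulus_nonneg[OF hol(1), of X] X1
        by (cases "max_modulus h X = 0") auto
      have "max_modulus h X \<le> max_modulus h (X powr a)"
        using X1 a powr_mono[of 1 a X] by (intro max_modulus_mono hol) auto
      with pos have "ln (max_modulus h (X powr a)) \<le> ln (2 * exp ((1 + d) * s))"
        using up by (intro ln_mono) auto
      also have "\<dots> = ln 2 + (1 + d) * s"
        by (simp add: ln_mult)
      finally have "(1 + 2 * d) * ln (max_modulus h X) \<le> ln 2 + (1 + d) * s"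
        using elim by (simp add: X_def)
      moreover have "(1 + 2 * d) * s \<le> (1 + 2 * d) * ln (max_modulus h X)"
        using s d by (intro mult_left_mono) auto
      ultimately have "d * s \<le> ln 2"
        by (simp add: algebra_simps)
      then show False
        using elim d by (simp add: field_simps)
    qed
  qed
qed

section \<open>Iterated logarithms and the lower order inequality\<close>

lemma iter_log_Suc: "iter_log (Suc k) x = ln (iter_log k x)"
  by (simp add: iter_log_def)

lemma filterlim_iter_log_at_top: "filterlim (iter_log k) at_top at_top"
proof (induction k)
  case 0
  then show ?case by (simp add: iter_log_def id_def filterlim_ident)
next
  case (Suc k)
  then show ?case
    unfolding iter_log_Suc[abs_def] by (rule filterlim_compose[OF ln_at_top])
qed

text \<open>Quantifying over all y above x allows a comparison of two radii when only the smaller is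
  known to tend to infinity.\<close>

lemma iter_log_mono:
  "\<forall>\<^sub>F x in at_top. \<forall>y\<ge>x. iter_log k x \<le> iter_log k y"
proof (induction k)
  case 0
  then show ?case by (simp add: iter_log_def)
next
  case (Suc k)
  have "\<forall>\<^sub>F x in at_top. 0 < iter_log k x"
    using filterlim_iter_log_at_top by (simp add: filterlim_at_top_dense)
  with Suc show ?case
    by eventually_elim (auto simp: iter_log_Suc)
qed

text \<open>The first logarithm turns the exponent into the factor \<open>\<kappa>\<close>. Each
  further one keeps the bound, because ln (\<kappa> t) = ln \<kappa> + ln t is at most \<kappa> ln t
  once ln t >= 1.\<close>

lemma iter_log_powr_le:
  assumes "1 \<le> k" "1 \<le> \<kappa>"
  shows "\<forall>\<^sub>F x in at_top. iter_log k (x powr \<kappa>) \<le> \<kappa> * iter_log k x"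
  using assms(1)
proof (induction k rule: nat_induct_at_least)
  case base
  show ?case
    using eventually_gt_at_top[of 0] by eventually_elim (simp add: iter_log_def ln_powr)
next
  case (Suc k)
  have "\<forall>\<^sub>F x in at_top. 0 < iter_log k x" "\<forall>\<^sub>F x in at_top. 1 < ln (iter_log k x)"
    using filterlim_iter_log_at_top[of k] filterlim_iter_log_at_top[of "Suc k"]
    by (simp_all add: filterlim_at_top_dense iter_log_Suc)
  then show ?case
    using Suc.IH iter_log_mono[of k] eventually_ge_at_top[of 1]
  proof eventually_elim
    case (elim x)
    have "x \<le> x powr \<kappa>"
      using powr_mono[of 1 \<kappa> x] assms(2) elim by simp
    then have pos: "0 < iter_log k (x powr \<kappa>)"
      using elim by force
    then have "ln (iter_log k (x powr \<kappa>)) \<le> ln (\<kappa> * iter_log k x)"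
      using elim by (intro ln_mono) auto
    also have "\<dots> = ln \<kappa> + ln (iter_log k x)"
      using elim assms(2) by (simp add: ln_mult)
    also have "\<dots> \<le> (\<kappa> - 1) * ln (iter_log k x) + ln (iter_log k x)"
    proof -
      have "ln \<kappa> \<le> \<kappa> - 1"
        using assms(2) by (intro ln_le_minus_one) simp
      also have "(\<kappa> - 1) * 1 \<le> (\<kappa> - 1) * ln (iter_log k x)"
        using assms(2) elim by (intro mult_left_mono) auto
      finally show ?thesis by simp
    qed
    finally show ?case
      by (simp add: iter_log_Suc algebra_simps)
  qed
qed

lemma min_iter_log_nevanlinna_T_inv_le:
  assumes h: "nonconstant_entire h" and g: "nonconstant_entire g1" "nonconstant_entire g2"
    and le: "\<And>z. norm (h z) \<le> norm (g1 z) + norm (g2 z)" and k: "1 < \<kappa>" and p: "1 \<le> p"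
  shows "\<forall>\<^sub>F s in at_top.
    min (iter_log p (nevanlinna_T_inv g1 s)) (iter_log p (nevanlinna_T_inv g2 s))
      \<le> \<kappa> * iter_log p (nevanlinna_T_inv h s)"
proof -
  note mono = eventually_compose_filterlim[OF iter_log_mono[of p] filterlim_nevanlinna_T_inv_at_top]
  have "\<forall>\<^sub>F s in at_top. iter_log p (nevanlinna_T_inv h s powr \<kappa>)
      \<le> \<kappa> * iter_log p (nevanlinna_T_inv h s)"
    using k p by (intro eventually_compose_filterlim[OF iter_log_powr_le]
        filterlim_nevanlinna_T_inv_at_top h) auto
  then show ?thesis
    using min_nevanlinna_T_inv_le[OF h g le k] mono[OF g(1)] mono[OF g(2)]
  proof eventually_elim
    case (elim s)
    then consider "nevanlinna_T_inv g1 s \<le> nevanlinna_T_inv h s powr \<kappa>"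
      | "nevanlinna_T_inv g2 s \<le> nevanlinna_T_inv h s powr \<kappa>"
      by (auto simp: min_le_iff_disj)
    then show ?case
      using elim by cases (force simp: min_le_iff_disj)+
  qed
qed

lemma rel_lower_order_ge_min:
  assumes h: "nonconstant_entire h" and g: "nonconstant_entire g1" "nonconstant_entire g2"
    and le: "\<And>z. norm (h z) \<le> norm (g1 z) + norm (g2 z)" and p: "1 \<le> p"
    and phi: "filterlim \<phi> at_top at_top" and f: "filterlim (nevanlinna_T f) at_top at_top"
  shows "min (rel_lower_order p q \<phi> g1 f) (rel_lower_order p q \<phi> g2 f) \<le> rel_lower_order p q \<phi> h f"
proof -
  define A where "A = (\<lambda>g r. iter_log p (nevanlinna_T_inv g (nevanlinna_T f r)))"
  define D where "D = (\<lambda>r. iter_log q (\<phi> r))"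
  have order: "rel_lower_order p q \<phi> g f = Liminf at_top (\<lambda>r. ereal (A g r / D r))" for g
    by (simp add: rel_lower_order_def A_def D_def)
  have D: "\<forall>\<^sub>F r in at_top. 0 < D r"
    using filterlim_compose[OF filterlim_iter_log_at_top phi]
    by (simp add: D_def filterlim_at_top_dense)
  have "filterlim (A h) at_top at_top"
    unfolding A_def by (intro filterlim_compose[OF filterlim_iter_log_at_top]
        filterlim_compose[OF filterlim_nevanlinna_T_inv_at_top] h f)
  then have A: "\<forall>\<^sub>F r in at_top. 0 < A h r"
    by (simp add: filterlim_at_top_dense)
  show ?thesis
    unfolding order[of h] le_Liminf_iff
  proof (intro allI impI)
    fix y
    assume y: "y < min (rel_lower_order p q \<phi> g1 f) (rel_lower_order p q \<phi> g2 f)"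
    show "\<forall>\<^sub>F r in at_top. y < ereal (A h r / D r)"
    proof (cases "y < 0")
      case True
      show ?thesis
        using A D by eventually_elim (use True in \<open>auto intro: less_le_trans\<close>)
    next
      case False
      \<comment> \<open>Two reals w < z are placed between y and the minimum; the ratio z / w serves
        as \<open>\<kappa>\<close>, and dividing by it lowers the bound only from z to w.\<close>
      obtain w where w: "y < ereal w" "ereal w < min (rel_lower_order p q \<phi> g1 f) (rel_lower_order p q \<phi> g2 f)"
        using ereal_dense2[OF y] by blast
      obtain z where z: "ereal w < ereal z" "ereal z < min (rel_lower_order p q \<phi> g1 f) (rel_lower_order p q \<phi> g2 f)"
        using ereal_dense2[OF w(2)] by blast
      have "0 < ereal w" using False w(1) by (metis le_less_trans not_less)
      then have w0: "0 < w" by simp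
      then have k: "1 < z / w" using z(1) by simp
      have "\<forall>\<^sub>F r in at_top. ereal z < ereal (A g1 r / D r)"
        "\<forall>\<^sub>F r in at_top. ereal z < ereal (A g2 r / D r)"
        using z(2) unfolding order by (auto dest: less_LiminfD)
      then show ?thesis
        using D eventually_compose_filterlim[OF min_iter_log_nevanlinna_T_inv_le[OF h g le k p] f]
      proof eventually_elim
        case (elim r)
        have "z * D r < min (A g1 r) (A g2 r)"
          using elim by (simp add: field_simps)
        also have "\<dots> \<le> z / w * A h r"
          using elim by (simp add: A_def)
        finally have "w * D r < A h r"
          using w0 z(1) by (simp add: field_simps)
        then have "w < A h r / D r"
          using elim by (simp add: field_simps)
        with w(1) show ?case
          by (meson less_trans ereal_less_eq(3) less_ereal.simps(1))
      qed
    qed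
  qed
qed

section \<open>Growth of the characteristic of a meromorphic function\<close>

lemma finite_poles_cball:
  assumes "f meromorphic_on UNIV"
  shows "finite {z \<in> cball 0 r. is_pole f z}"
proof -
  have "{w. \<not> f analytic_on {w}} sparse_in cball 0 r"
    by (rule sparse_in_subset[OF meromorphic_on_imp_sparse_singularities[OF assms]]) simp
  then have "finite (cball 0 r \<inter> {w. \<not> f analytic_on {w}})"
    by (rule sparse_in_compact_finite) simp
  then show ?thesis
    by (rule rev_finite_subset) (use analytic_at_imp_no_pole in auto)
qed

text \<open>The contribution of a pole of multiplicity m at modulus a > 0 to the integrated counting
  function.\<close>

lemma has_integral_inverse_restrict:
  fixes a r m :: real
  assumes "0 < a" "a \<le> r"
  shows "((\<lambda>t. if a \<le> t then m / t else 0) has_integral m * ln (r / a)) {0..r}"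
proof -
  have "((\<lambda>t. m / t) has_integral m * ln r - m * ln a) {a..r}"
  proof (rule fundamental_theorem_of_calculus[where f = "\<lambda>t. m * ln t"])
    show "((\<lambda>t. m * ln t) has_vector_derivative m / t) (at t within {a..r})" if "t \<in> {a..r}" for t
      unfolding has_real_derivative_iff_has_vector_derivative[symmetric]
      using that assms by (auto intro!: derivative_eq_intros)
  qed fact
  then have "((\<lambda>t. m / t) has_integral m * ln (r / a)) {a..r}"
    using assms by (simp add: ln_div right_diff_distrib)
  then have "((\<lambda>t. if t \<in> {a..r} then m / t else 0) has_integral m * ln (r / a)) {0..r}"
    using assms by (subst has_integral_restrict) auto
  then show ?thesis
    by (rule has_integral_eq[rotated]) auto
qed

text \<open>Over the fixed finite set of poles in the large disc, the count is a sum of step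
  functions and can be integrated termwise. A pole at 0 enters through the separate ln r term, hence
  the value 1 in place of its modulus.\<close>

lemma counting_fun_eq_sum:
  assumes f: "f meromorphic_on UNIV" and r: "0 < r"
  shows "counting_fun f r = (\<Sum>z | z \<in> cball 0 r \<and> is_pole f z.
    real_of_int (- zorder f z) * ln (r / (if z = 0 then 1 else norm z)))"
proof -
  define P where "P = {z. z \<in> cball 0 r \<and> is_pole f z}"
  define m where "m = (\<lambda>z. real_of_int (- zorder f z))"
  have fin: "finite P"
    using finite_poles_cball[OF f, of r] by (simp add: P_def)
  have pc: "pole_count f t = (\<Sum>z\<in>P. if norm z \<le> t then m z else 0)" if "t \<le> r" for t
  proof -
    have "{z. z \<in> cball 0 t \<and> is_pole f z} = P \<inter> {z. norm z \<le> t}"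
      using that by (auto simp: P_def)
    then show ?thesis
      using fin by (simp add: pole_count_def m_def sum.If_cases)
  qed
  have "((\<lambda>t. if z = 0 then 0 else if norm z \<le> t then m z / t else 0) has_integral
      (if z = 0 then 0 else m z * ln (r / norm z))) {0..r}" if "z \<in> P" for z
    using that has_integral_inverse_restrict[of "norm z" r "m z"] by (auto simp: P_def)
  then have "((\<lambda>t. \<Sum>z\<in>P. if z = 0 then 0 else if norm z \<le> t then m z / t else 0) has_integral
      (\<Sum>z\<in>P. if z = 0 then 0 else m z * ln (r / norm z))) {0..r}"
    by (rule has_integral_sum[OF fin])
  moreover have "(pole_count f t - pole_count f 0) / t
      = (\<Sum>z\<in>P. if z = 0 then 0 else if norm z \<le> t then m z / t else 0)" if "t \<in> {0..r}" for t
  proof -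
    have "(pole_count f t - pole_count f 0) / t
        = (\<Sum>z\<in>P. ((if norm z \<le> t then m z else 0) - (if norm z \<le> 0 then m z else 0)) / t)"
      using that r by (simp only: pc atLeastAtMost_iff order_less_imp_le sum_subtractf flip: sum_divide_distrib)
    also have "\<dots> = (\<Sum>z\<in>P. if z = 0 then 0 else if norm z \<le> t then m z / t else 0)"
      using that by (intro sum.cong) auto
    finally show ?thesis .
  qed
  ultimately have "((\<lambda>t. (pole_count f t - pole_count f 0) / t) has_integral
      (\<Sum>z\<in>P. if z = 0 then 0 else m z * ln (r / norm z))) {0..r}"
    by (metis (no_types, lifting) has_integral_cong)
  then have "counting_fun f r
      = (\<Sum>z\<in>P. if z = 0 then 0 else m z * ln (r / norm z)) + pole_count f 0 * ln r"
    by (simp add: counting_fun_def integral_unique)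
  also have "\<dots> = (\<Sum>z\<in>P. (if z = 0 then 0 else m z * ln (r / norm z)) + (if norm z \<le> 0 then m z else 0) * ln r)"
    using r by (simp only: pc order_less_imp_le sum.distrib sum_distrib_right)
  also have "\<dots> = (\<Sum>z\<in>P. m z * ln (r / (if z = 0 then 1 else norm z)))"
    by (intro sum.cong) auto
  finally show ?thesis
    by (simp add: P_def m_def)
qed

text \<open>For r >= 1 every pole in the disc contributes a nonnegative term, so the logarithmic
  growth from the single pole b is a lower bound.\<close>

lemma filterlim_nevanlinna_T_pole:
  assumes f: "f meromorphic_on UNIV" and b: "is_pole f b"
  shows "filterlim (nevanlinna_T f) at_top at_top"
proof -
  define c where "c = (\<lambda>z::complex. if z = 0 then 1 else norm z)"
  have c: "0 < c z" for z by (simp add: c_def)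
  have "filterlim (\<lambda>r. 1 / c b * r) at_top at_top"
    using c by (intro filterlim_tendsto_pos_mult_at_top[OF tendsto_const] filterlim_ident) simp
  then have "filterlim (\<lambda>r. ln (1 / c b * r)) at_top at_top"
    by (rule filterlim_compose[OF ln_at_top])
  moreover have "\<forall>\<^sub>F r in at_top. ln (1 / c b * r) \<le> nevanlinna_T f r"
    using eventually_ge_at_top[of "max 1 (norm b)"]
  proof eventually_elim
    case (elim r)
    define P where "P = {z. z \<in> cball 0 r \<and> is_pole f z}"
    have fin: "finite P"
      using finite_poles_cball[OF f, of r] by (simp add: P_def)
    have m: "1 \<le> real_of_int (- zorder f z)" if "z \<in> P" for z
      using isolated_pole_imp_neg_zorder[of f z] that meromorphic_on_isolated_singularity[of f z] f
        meromorphic_on_subset[OF f]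
      by (force simp: P_def)
    have l: "0 \<le> ln (r / c z)" if "z \<in> P" for z
      using that elim c[of z] by (auto simp: P_def c_def)
    have bP: "b \<in> P" using elim b by (simp add: P_def)
    have "1 * ln (r / c b) \<le> real_of_int (- zorder f b) * ln (r / c b)"
      using m l bP by (intro mult_right_mono) auto
    also have "\<dots> \<le> (\<Sum>z\<in>P. real_of_int (- zorder f z) * ln (r / c z))"
      using fin bP by (intro member_le_sum mult_nonneg_nonneg l order_trans[OF zero_le_one m]) auto
    also have "\<dots> = counting_fun f r"
      using elim by (subst counting_fun_eq_sum[OF f]) (auto simp: P_def c_def)
    also have "\<dots> \<le> nevanlinna_T f r"
      using proximity_fun_nonneg by (simp add: nevanlinna_T_def)
    finally show ?case by simp
  qed
  ultimately show ?thesis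
    by (rule filterlim_at_top_mono)
qed

text \<open>A sparse set meets the closed disc in finitely many points, hence finitely many angles
  are affected and the integral does not change.\<close>

lemma proximity_fun_eq_of_cosparse:
  assumes "\<forall>\<^sub>\<approx>z. F z = f z" and r: "0 < r"
  shows "proximity_fun F r = proximity_fun f r"
proof -
  define N where "N = cball 0 r \<inter> {z. F z \<noteq> f z}"
  have "{z. F z \<noteq> f z} sparse_in cball 0 r"
    by (rule sparse_in_subset[of _ UNIV]) (use assms in \<open>auto simp: eventually_cosparse\<close>)
  then have fin: "finite N"
    unfolding N_def by (rule sparse_in_compact_finite) simp
  define e where "e = (\<lambda>\<theta>. of_real r * cis \<theta>)"
  have "inj_on e {0..<2 * pi}"
  proof (rule inj_onI)
    fix x y assume xy: "x \<in> {0..<2 * pi}" "y \<in> {0..<2 * pi}" "e x = e y"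
    then have "exp (\<i> * of_real x) = exp (\<i> * of_real y)"
      using r by (simp add: e_def cis_conv_exp)
    then have "\<i> * of_real x = \<i> * of_real y"
      by (rule exp_complex_eqI[rotated]) (use xy in auto)
    then show "x = y" by simp
  qed
  then have "finite ({0..<2 * pi} \<inter> e -` N)"
    using fin by (simp add: finite_vimage_IntI Int_commute)
  \<comment> \<open>The angle 2 pi is added because the parametrisation is injective only on the
    half-open interval.\<close>
  then have neg: "finite (insert (2 * pi) ({0..<2 * pi} \<inter> e -` N))"
    by simp
  have "integral {0..2 * pi} (\<lambda>\<theta>. log_plus (norm (F (e \<theta>))))
      = integral {0..2 * pi} (\<lambda>\<theta>. log_plus (norm (f (e \<theta>))))"
  proof (rule integral_spike[OF negligible_finite[OF neg]])
    fix x assume "x \<in> {0..2 * pi} - insert (2 * pi) ({0..<2 * pi} \<inter> e -` N)"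
    then have "e x \<notin> N" by auto
    moreover have "norm (e x) = r" using r by (simp add: e_def norm_mult)
    ultimately show "log_plus (norm (f (e x))) = log_plus (norm (F (e x)))"
      by (simp add: N_def)
  qed
  then show ?thesis
    by (simp add: proximity_fun_def e_def)
qed

text \<open>Without poles, correcting the values at removable singularities gives an entire function
  with the same characteristic for r > 0. The constant alternative is the one that a nonzero lower
  order excludes.\<close>

lemma nevanlinna_T_meromorphic_cases:
  assumes f: "f meromorphic_on UNIV"
  shows "filterlim (nevanlinna_T f) at_top at_top \<or> (\<exists>c. \<forall>r>0. nevanlinna_T f r = c)"
proof (cases "\<exists>b. is_pole f b")
  case True
  then show ?thesis using filterlim_nevanlinna_T_pole[OF f] by blast
next
  case False
  define F where "F = remove_sings f"
  have "F analytic_on {z}" for z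
  proof -
    have "isolated_singularity_at f z" "not_essential f z"
      using f by (auto intro: meromorphic_on_isolated_singularity meromorphic_on_not_essential
          meromorphic_on_subset)
    then show ?thesis
      using False remove_sings_analytic_at unfolding F_def not_essential_def by blast
  qed
  then have hol: "F holomorphic_on UNIV"
    using analytic_imp_holomorphic analytic_on_analytic_at by blast
  have T: "nevanlinna_T f r = nevanlinna_T F r" if "0 < r" for r
    using False proximity_fun_eq_of_cosparse[OF eventually_remove_sings_eq[OF f] that]
    by (simp add: nevanlinna_T_entire[OF hol] nevanlinna_T_eq_proximity_fun flip: F_def)
  show ?thesis
  proof (cases "F constant_on UNIV")
    case True
    then obtain c where "F = (\<lambda>_. c)"
      by (auto simp: constant_on_def)
    then have "nevanlinna_T F r = nevanlinna_T F 1" for r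
      unfolding nevanlinna_T_entire[OF hol] by (simp add: proximity_fun_def)
    with T show ?thesis by metis
  next
    case False
    then have "filterlim (nevanlinna_T F) at_top at_top"
      using hol by (intro filterlim_nevanlinna_T_at_top) (simp add: nonconstant_entire_def)
    moreover have "\<forall>\<^sub>F r in at_top. nevanlinna_T f r = nevanlinna_T F r"
      using eventually_gt_at_top[of 0] by eventually_elim (rule T)
    ultimately show ?thesis
      using filterlim_cong[OF refl refl] by blast
  qed
qed

section \<open>The sum theorem\<close>

lemma filterlim_mono_on_unbounded:
  fixes \<phi> :: "real \<Rightarrow> real"
  assumes "mono_on {0..} \<phi>" "\<not> bdd_above (\<phi> ` {0..})"
  shows "filterlim \<phi> at_top at_top"
  unfolding filterlim_at_top
proof
  fix B
  obtain x where x: "0 \<le> x" "B \<le> \<phi> x"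
    using assms(2) unfolding bdd_above_def by (metis atLeast_iff image_iff linear)
  show "\<forall>\<^sub>F r in at_top. B \<le> \<phi> r"
    using eventually_ge_at_top[of x]
  proof eventually_elim
    case (elim r)
    then have "\<phi> x \<le> \<phi> r"
      using x by (intro mono_onD[OF assms(1)]) auto
    with x show ?case by simp
  qed
qed

text \<open>The number \<open>c\<close> may lie outside the range of the characteristic of \<open>g\<close>; the junk value of the
  inverse there does no harm because it is independent of \<open>r\<close>.\<close>
lemma rel_lower_order_eq_0_if_nevanlinna_T_const:
  assumes phi: "filterlim \<phi> at_top at_top" and c: "\<And>r. 0 < r \<Longrightarrow> nevanlinna_T f r = c"
  shows "rel_lower_order p q \<phi> g f = 0"
proof -
  define K where "K = iter_log p (nevanlinna_T_inv g c)"
  have "((\<lambda>r. K / iter_log q (\<phi> r)) \<longlongrightarrow> 0) at_top"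
    by (rule tendsto_divide_0[OF tendsto_const filterlim_at_top_imp_at_infinity])
      (rule filterlim_compose[OF filterlim_iter_log_at_top phi])
  moreover have "\<forall>\<^sub>F r in at_top. K / iter_log q (\<phi> r)
      = iter_log p (nevanlinna_T_inv g (nevanlinna_T f r)) / iter_log q (\<phi> r)"
    using eventually_gt_at_top[of 0] by eventually_elim (simp add: K_def c)
  ultimately have "((\<lambda>r. iter_log p (nevanlinna_T_inv g (nevanlinna_T f r)) / iter_log q (\<phi> r))
      \<longlongrightarrow> 0) at_top"
    by (rule Lim_transform_eventually)
  then show ?thesis
    unfolding rel_lower_order_def zero_ereal_def
    by (intro lim_imp_Liminf tendsto_ereal) auto
qed

theorem theorem3:
  fixes p q :: nat and \<phi> :: "real \<Rightarrow> real"
    and f1 g1 g2 h :: "complex \<Rightarrow> complex"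
  assumes "p \<ge> 1" and "q \<ge> 1"
    and "mono_on {0..} \<phi>" and "\<And>r. r \<ge> 0 \<Longrightarrow> \<phi> r > 0" and "\<not> bdd_above (\<phi> ` {0..})"
    and "f1 meromorphic_on UNIV"
    and "nonconstant_entire g1" and "nonconstant_entire g2"
    and "h = (\<lambda>z. g1 z + g2 z) \<or> h = (\<lambda>z. g1 z - g2 z)"
    and "nonzero_finite (rel_lower_order p q \<phi> g1 f1)"
    and "nonzero_finite (rel_lower_order p q \<phi> g2 f1)"
    and "nonzero_finite (rel_lower_order p q \<phi> h f1)"
    and "property_A h"
  shows "rel_lower_order p q \<phi> h f1
           \<ge> min (rel_lower_order p q \<phi> g1 f1) (rel_lower_order p q \<phi> g2 f1) \<and>
         (rel_lower_order p q \<phi> g1 f1 \<noteq> rel_lower_order p q \<phi> g2 f1 \<longrightarrow>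
          rel_lower_order p q \<phi> h f1
            = min (rel_lower_order p q \<phi> g1 f1) (rel_lower_order p q \<phi> g2 f1))"
proof -
  note ent = assms(7,8) and order = assms(10)
  have h: "nonconstant_entire h"
    using assms(13) by (simp add: property_A_def)
  have phi: "filterlim \<phi> at_top at_top"
    by (rule filterlim_mono_on_unbounded[OF assms(3,5)])
  \<comment> \<open>A constant characteristic would make the lower order 0, contrary to the standing
    assumption.\<close>
  have "\<not> (\<forall>r>0. nevanlinna_T f1 r = c)" for c
    using rel_lower_order_eq_0_if_nevanlinna_T_const[OF phi, of f1 c p q g1] order
    by (auto simp: nonzero_finite_def)
  then have f: "filterlim (nevanlinna_T f1) at_top at_top"
    using nevanlinna_T_meromorphic_cases[OF assms(6)] by blast
  have le: "norm (h z) \<le> norm (g1 z) + norm (g2 z)" "norm (g1 z) \<le> norm (h z) + norm (g2 z)"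
    "norm (g2 z) \<le> norm (h z) + norm (g1 z)" for z
    using assms(9) norm_triangle_ineq[of "g1 z" "g2 z"] norm_triangle_ineq4[of "g1 z" "g2 z"]
      norm_triangle_ineq4[of "h z" "g2 z"] norm_triangle_ineq[of "h z" "g2 z"]
      norm_triangle_ineq4[of "h z" "g1 z"] norm_triangle_ineq4[of "g1 z" "h z"]
    by (auto simp: norm_minus_commute)
  have "min (rel_lower_order p q \<phi> g1 f1) (rel_lower_order p q \<phi> g2 f1) \<le> rel_lower_order p q \<phi> h f1"
    "min (rel_lower_order p q \<phi> h f1) (rel_lower_order p q \<phi> g2 f1) \<le> rel_lower_order p q \<phi> g1 f1"
    "min (rel_lower_order p q \<phi> h f1) (rel_lower_order p q \<phi> g1 f1) \<le> rel_lower_order p q \<phi> g2 f1"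
    using h ent le assms(1) phi f by (blast intro: rel_lower_order_ge_min)+
  \<comment> \<open>If, say, the order for g1 is the smaller one, the second inequality forces the
    order for h down to it, and the first gives the reverse bound.\<close>
  then show ?thesis
    by (auto simp: min_def split: if_splits)
qed

end
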